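(* Let $\varepsilon\in(0,2]$, $q=1+\varepsilon/2$ and $r=\frac{q}{q-1}$. Assume that for every $x\in\mathbb{R}^n$ $$f(x)=\mathbb{E}_\xi[F(x,\xi)],\qquad \mathbb{E}_\xi\left[|F(x,\xi)-f(x)|^r\right]\le M_r<+\infty ,$$ with $M_r$ independent of $x$. Then $O(\Delta_k^{-2-\varepsilon})$ samples at iteration $k$ are sufficient to satisfy the tail bound condition with exponent $q$ (defined in the context): there are a function $p:(0,\infty)\to\{1,2,3,\dots\}$ with $p(\delta)=O(\delta^{-2-\varepsilon})$ as $\delta\to0^+$ and a constant $\varepsilon_q>0$ such that, if for every $k$ the estimates $F_k$ and $F_k^g$ are sample averages (see context) with $p_k=p(\Delta_k)$ samples each, then the tail bound condition with exponent $q$ holds with the constant $\varepsilon_q$.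
   Context: $f:\mathbb{R}^n\to\mathbb{R}$ is locally Lipschitz continuous with $\inf f=f^*\in\mathbb{R}$, and $F(x,\xi)$ is a stochastic oracle, where $\xi$ is a random variable that can be sampled. On a probability space, a stochastic derivative-free algorithm generates, for $k=0,1,2,\dots$, random iterates $X_k\in\mathbb{R}^n$, random stepsizes $\Delta_k>0$, random directions $G_k\in\mathbb{R}^n$, and real random variables $F_k$, $F_k^g$ which are estimates of $f(X_k)$ and $f(X_k+\Delta_kG_k)$ respectively. $\mathcal{F}_{k-1}$ is the $\sigma$-algebra generated by $(F_j,F_j^g)_{j=0}^{k-1}$ and $(G_j)_{j=0}^{k}$. $X_0$ and $\Delta_0$ are deterministic and $(X_{k+1},\Delta_{k+1})$ is determined by $(X_k,\Delta_k,G_k,F_k,F_k^g)$, so $X_k,\Delta_k,G_k$ are $\mathcal{F}_{k-1}$-measurable. Tail bound condition with exponent $q>1$: for some $\varepsilon_q>0$ (independent of $k$), for every $k$ and every $\alpha>0$, almost surely $$\mathbb{P}\left(|F_k-F_k^g-(f(X_k)-f(X_k+\Delta_kG_k))|\ge \alpha\Delta_k^q \,\middle|\, \mathcal{F}_{k-1}\right)\le \frac{\varepsilon_q}{\alpha^{q/(q-1)}} .$$ Sample-average estimates with $p_k$ samples: $F_k=\frac1{p_k}\sum_{i=1}^{p_k}F(X_k,\xi_{k,i})$ and $F_k^g=\frac1{p_k}\sum_{i=1}^{p_k}F(X_k+\Delta_kG_k,\xi^g_{k,i})$, where $\xi_{k,i},\xi^g_{k,i}$ are i.i.d. copies of $\xi$,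 independent of $\mathcal{F}_{k-1}$. *)

theory Defs
  imports "HOL-Probability.Probability" "HOL-Library.Landau_Symbols"
begin

definition locally_lipschitz :: "('a::metric_space \<Rightarrow> 'b::metric_space) \<Rightarrow> bool" where
  "locally_lipschitz f \<longleftrightarrow> (\<forall>x. \<exists>u>0. \<exists>L. L-lipschitz_on (cball x u) f)"

definition rv_events :: "'w measure \<Rightarrow> 'b measure \<Rightarrow> ('i \<Rightarrow> 'w \<Rightarrow> 'b) \<Rightarrow> 'i set \<Rightarrow> 'w set set" where
  "rv_events M N Z I = (\<Union>i\<in>I. {Z i -` A \<inter> space M | A. A \<in> sets N})"

text \<open>
  \<open>past_algebra M G Fe Fg k\<close> is the \<open>\<sigma>\<close>-algebra written $\mathcal{F}_{k-1}$ in the literature: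
  function estimates up to iteration \<open>k - 1\<close>, but directions up to and including iteration \<open>k\<close>.
\<close>
definition past_algebra ::
  "'w measure \<Rightarrow> (nat \<Rightarrow> 'w \<Rightarrow> real^'n) \<Rightarrow> (nat \<Rightarrow> 'w \<Rightarrow> real) \<Rightarrow> (nat \<Rightarrow> 'w \<Rightarrow> real) \<Rightarrow> nat \<Rightarrow> 'w measure"
  where
  "past_algebra M G Fe Fg k =
     sigma (space M)
       (rv_events M borel Fe {..<k} \<union> rv_events M borel Fg {..<k} \<union> rv_events M borel G {..k})"

text \<open>
  \<open>Fe k\<close> and \<open>Fg k\<close> are the estimates of \<open>f\<close> at \<open>X k\<close> and at \<open>X k + \<Delta> k *\<^sub>R G k\<close>. The update rule
  may change with the iteration; it is Borel, which is what makes \<open>X k\<close> and \<open>\<Delta> k\<close>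
  measurable with respect to \<open>past_algebra M G Fe Fg k\<close>.
\<close>
locale stochastic_dfo = prob_space M
  for M :: "'w measure" +
  fixes X :: "nat \<Rightarrow> 'w \<Rightarrow> real^'n"
    and \<Delta> :: "nat \<Rightarrow> 'w \<Rightarrow> real"
    and G :: "nat \<Rightarrow> 'w \<Rightarrow> real^'n"
    and Fe Fg :: "nat \<Rightarrow> 'w \<Rightarrow> real"
  assumes G_measurable: "\<And>k. G k \<in> borel_measurable M"
    and Fe_measurable: "\<And>k. Fe k \<in> borel_measurable M"
    and Fg_measurable: "\<And>k. Fg k \<in> borel_measurable M"
    and stepsize_pos: "\<And>k \<omega>. \<omega> \<in> space M \<Longrightarrow> \<Delta> k \<omega> > 0"
    and init_deterministic: "\<exists>x0 \<delta>0. \<forall>\<omega>\<in>space M. X 0 \<omega> = x0 \<and> \<Delta> 0 \<omega> = \<delta>0"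
    and update: "\<And>k. \<exists>U \<in> borel \<rightarrow>\<^sub>M borel. \<forall>\<omega>\<in>space M.
        (X (Suc k) \<omega>, \<Delta> (Suc k) \<omega>) = U (X k \<omega>, \<Delta> k \<omega>, G k \<omega>, Fe k \<omega>, Fg k \<omega>)"

text \<open>
  The conditional probability of an event given a \<open>\<sigma>\<close>-algebra is the conditional expectation of
  its indicator function.
\<close>
definition tail_bound ::
  "'w measure \<Rightarrow> (real^'n \<Rightarrow> real) \<Rightarrow> (nat \<Rightarrow> 'w \<Rightarrow> real^'n) \<Rightarrow> (nat \<Rightarrow> 'w \<Rightarrow> real) \<Rightarrow>
   (nat \<Rightarrow> 'w \<Rightarrow> real^'n) \<Rightarrow> (nat \<Rightarrow> 'w \<Rightarrow> real) \<Rightarrow> (nat \<Rightarrow> 'w \<Rightarrow> real) \<Rightarrow> real \<Rightarrow> real \<Rightarrow> bool" where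
  "tail_bound M f X \<Delta> G Fe Fg q \<epsilon>q \<longleftrightarrow>
     (\<forall>k. \<forall>\<alpha>>0. AE \<omega> in M.
        real_cond_exp M (past_algebra M G Fe Fg k)
          (indicator {\<omega>' \<in> space M.
             \<bar>Fe k \<omega>' - Fg k \<omega>' - (f (X k \<omega>') - f (X k \<omega>' + \<Delta> k \<omega>' *\<^sub>R G k \<omega>'))\<bar>
               \<ge> \<alpha> * \<Delta> k \<omega>' powr q}) \<omega>
        \<le> \<epsilon>q / \<alpha> powr (q / (q - 1)))"

text \<open>
  \<open>D\<close> is the law of the random variable \<open>\<xi>\<close>. Since the number of samples \<open>p (\<Delta> k \<omega>)\<close> is random,
  each iteration comes with two infinite sequences of samples, indexed from 1, of which the first
  \<open>p (\<Delta> k \<omega>)\<close> are used. All samples of one iteration, on both sides, are mutually independent,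
  and the whole collection is independent of the past; no relation between samples of different
  iterations is required beyond that.
\<close>
definition sample_averages ::
  "'w measure \<Rightarrow> 's measure \<Rightarrow> (real^'n \<Rightarrow> 's \<Rightarrow> real) \<Rightarrow> (real \<Rightarrow> nat) \<Rightarrow>
   (nat \<Rightarrow> 'w \<Rightarrow> real^'n) \<Rightarrow> (nat \<Rightarrow> 'w \<Rightarrow> real) \<Rightarrow> (nat \<Rightarrow> 'w \<Rightarrow> real^'n) \<Rightarrow>
   (nat \<Rightarrow> 'w \<Rightarrow> real) \<Rightarrow> (nat \<Rightarrow> 'w \<Rightarrow> real) \<Rightarrow>
   (nat \<Rightarrow> nat \<Rightarrow> 'w \<Rightarrow> 's) \<Rightarrow> (nat \<Rightarrow> nat \<Rightarrow> 'w \<Rightarrow> 's) \<Rightarrow> bool" where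
  "sample_averages M D F p X \<Delta> G Fe Fg \<xi> \<xi>g \<longleftrightarrow>
     (\<forall>k.
        prob_space.indep_vars M (\<lambda>_. D) (case_sum (\<xi> k) (\<xi>g k)) ({1..} <+> {1..}) \<and>
        (\<forall>i\<ge>1. distr M D (\<xi> k i) = D \<and> distr M D (\<xi>g k i) = D) \<and>
        prob_space.indep_set M
          (sets (past_algebra M G Fe Fg k))
          (sigma_sets (space M) (rv_events M D (case_sum (\<xi> k) (\<xi>g k)) ({1..} <+> {1..}))) \<and>
        (\<forall>\<omega>\<in>space M.
           Fe k \<omega> = (\<Sum>i = 1..p (\<Delta> k \<omega>). F (X k \<omega>) (\<xi> k i \<omega>)) / real (p (\<Delta> k \<omega>)) \<and>
           Fg k \<omega> = (\<Sum>i = 1..p (\<Delta> k \<omega>). F (X k \<omega> + \<Delta> k \<omega> *\<^sub>R G k \<omega>) (\<xi>g k i \<omega>))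
                     / real (p (\<Delta> k \<omega>))))"

end

theory Submission
  imports Defs
begin

text \<open>
  The number of samples is taken as \<open>p \<delta> = \<lceil>\<delta> powr (- 2 * q)\<rceil>\<close>, where \<open>2 * q = 2 + \<epsilon>\<close>. Since
  \<open>0 < \<epsilon> \<le> 2\<close>, the conjugate exponent \<open>r = q / (q - 1) = 1 + 2 / \<epsilon>\<close> is at least \<open>2\<close>. For such \<open>r\<close> the
  average of \<open>n\<close> independent samples with \<open>r\<close>-th central moment at most \<open>B\<close> has \<open>r\<close>-th central moment
  at most \<open>K * B * n powr (- r / 2)\<close> with \<open>K\<close> depending on \<open>r\<close> only, as if the error were of the order
  \<open>1 / sqrt n\<close>. With \<open>n = p \<delta> \<ge> \<delta> powr (- 2 * q)\<close> this moment is at most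
  \<open>K * B * \<delta> powr (q * r)\<close>, and Markov's inequality at the level \<open>\<alpha> * \<delta> powr q\<close> gives the tail
  \<open>K * B / \<alpha> powr r\<close>: the powers of the stepsize cancel, and the exponent of \<open>\<alpha>\<close> is the
  desired \<open>q / (q - 1)\<close>.

  Two points need work. The first is the moment inequality \<open>sum_moment_le\<close>, which is proved by adding
  one summand at a time. Its core is the pointwise expansion \<open>abs_add_powr_le\<close> of
  \<open>\<bar>a + b\<bar> powr r\<close>, whose linear term has mean zero by independence and whose quadratic term is
  absorbed by the two pure powers with an adjustable weight.

  The second is that the points of evaluation, the stepsize and hence the number of samples are random.
  They are determined by the past, however, and the samples are independent of the past, so
  \<open>real_cond_exp_freeze_independent\<close> identifies the conditional probability with an ordinary
  probability in which all these quantities are held fixed. There the moment inequality applies to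
  each of the two averages (\<open>two_sample_averages_tail\<close>).
\<close>

section \<open>Expansion of the power of a sum\<close>

text \<open>Convexity of \<open>x \<mapsto> x powr s\<close>. The point \<open>x = 0\<close> is handled by hand, because convexity is
  applied on the open half line.\<close>
lemma powr_ge_tangent:
  fixes s x y :: real
  assumes "s \<ge> 1" "x \<ge> 0" "y > 0"
  shows "x powr s \<ge> y powr s + s * y powr (s - 1) * (x - y)"
proof (cases "x = 0")
  case True
  have "1 * y powr s \<le> s * y powr s" using assms by (intro mult_right_mono) auto
  then show ?thesis using True assms by (simp add: powr_diff)
next
  case False
  have "x powr s - y powr s \<ge> s * y powr (s - 1) * (x - y)"
  proof (rule convex_on_imp_above_tangent[where A = "{0<..}"])
    show "convex_on {0<..} (\<lambda>x. x powr s)" using powr_convex[OF assms(1)] .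
    show "((\<lambda>x. x powr s) has_real_derivative s * y powr (s - 1)) (at y within {0<..})"
      using assms by (auto intro!: derivative_eq_intros)
    show "y \<in> interior {0<..}" using assms by (simp add: interior_open)
  qed (use assms False in auto)
  then show ?thesis by linarith
qed

text \<open>
  A second-order expansion at \<open>1\<close>, obtained by using convexity twice: the tangent of
  \<open>u powr r\<close> at \<open>u\<close> bounds the second-order error by
  \<open>r * (u powr (r - 1) - 1) * (u - 1)\<close>, and then a tangent of \<open>u powr (r - 1)\<close> bounds its first
  factor by a multiple of \<open>\<bar>u - 1\<bar>\<close>. This second step is where \<open>r \<ge> 2\<close> enters.\<close>
lemma powr_le_quadratic:
  fixes r u :: real
  assumes r: "r \<ge> 2" and u: "0 \<le> u" "u \<le> 2"
  shows "u powr r \<le> 1 + r * (u - 1) + r\<^sup>2 * 2 powr r * (u - 1)\<^sup>2"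
proof (cases "u = 0")
  case True
  have "r * 1 \<le> r * (r * 2 powr r)"
    using r mult_mono[of 1 r 1 "2 powr r"] ge_one_powr_ge_zero[of 2 r] by (intro mult_left_mono) auto
  then have "r \<le> r\<^sup>2 * 2 powr r" by (simp add: power2_eq_square mult.assoc)
  then show ?thesis using True by simp
next
  case False
  with u have u0: "u > 0" by simp
  have "1 \<ge> u powr r + r * u powr (r - 1) * (1 - u)"
    using powr_ge_tangent[of r 1 u] r u0 by simp
  then have 1: "u powr r - 1 - r * (u - 1) \<le> r * ((u powr (r - 1) - 1) * (u - 1))"
    by (simp add: algebra_simps)
  have 2: "(u powr (r - 1) - 1) * (u - 1) \<le> r * 2 powr r * (u - 1)\<^sup>2"
  proof (cases "u \<ge> 1")
    case True
    have "1 \<ge> u powr (r - 1) + (r - 1) * u powr (r - 1 - 1) * (1 - u)"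
      using powr_ge_tangent[of "r - 1" 1 u] r u0 by simp
    then have "u powr (r - 1) - 1 \<le> ((r - 1) * u powr (r - 2)) * (u - 1)"
      by (simp add: algebra_simps)
    also have "\<dots> \<le> (r * 2 powr r) * (u - 1)"
    proof (intro mult_right_mono mult_mono)
      have "u powr (r - 2) \<le> 2 powr (r - 2)" using u r by (intro powr_mono2) auto
      also have "\<dots> \<le> 2 powr r" by simp
      finally show "u powr (r - 2) \<le> 2 powr r" .
    qed (use True r in auto)
    finally have "(u powr (r - 1) - 1) * (u - 1) \<le> (r * 2 powr r) * (u - 1) * (u - 1)"
      using True by (intro mult_right_mono) auto
    then show ?thesis by (simp add: power2_eq_square mult.assoc)
  next
    case False
    have "u powr (r - 1) \<ge> 1 + (r - 1) * (u - 1)"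
      using powr_ge_tangent[of "r - 1" u 1] r u0 by simp
    then have "1 - u powr (r - 1) \<le> (r - 1) * (1 - u)" by (simp add: algebra_simps)
    also have "\<dots> \<le> (r * 2 powr r) * (1 - u)"
    proof (rule mult_right_mono)
      have "r * 1 \<le> r * 2 powr r" using r by (intro mult_left_mono ge_one_powr_ge_zero) auto
      then show "r - 1 \<le> r * 2 powr r" by linarith
    qed (use False in auto)
    finally have "(1 - u powr (r - 1)) * (1 - u) \<le> (r * 2 powr r) * (1 - u) * (1 - u)"
      using False by (intro mult_right_mono) auto
    then show ?thesis by (simp add: power2_eq_square algebra_simps)
  qed
  have "r * ((u powr (r - 1) - 1) * (u - 1)) \<le> r * (r * 2 powr r * (u - 1)\<^sup>2)"
    using 2 r by (intro mult_left_mono) auto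
  with 1 show ?thesis by (simp add: power2_eq_square mult.assoc)
qed

text \<open>The quadratic expansion is valid for small \<open>t\<close>, whereas for large \<open>t\<close> the left-hand side and the
  linear term are both dominated by \<open>\<bar>t\<bar> powr r\<close>.\<close>
lemma abs_one_plus_powr_le:
  fixes r t :: real
  assumes r: "r \<ge> 2"
  shows "\<bar>1 + t\<bar> powr r \<le> 1 + r * t + r\<^sup>2 * 2 powr r * (t\<^sup>2 + \<bar>t\<bar> powr r)"
proof (cases "\<bar>t\<bar> \<le> 1")
  case True
  have "\<bar>1 + t\<bar> powr r \<le> 1 + r * t + r\<^sup>2 * 2 powr r * t\<^sup>2"
    using powr_le_quadratic[of r "1 + t"] r True by auto
  also have "\<dots> \<le> 1 + r * t + r\<^sup>2 * 2 powr r * (t\<^sup>2 + \<bar>t\<bar> powr r)"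
    by (intro add_left_mono mult_left_mono) auto
  finally show ?thesis .
next
  case False
  have "\<bar>t\<bar> powr 1 \<le> \<bar>t\<bar> powr r" using False r by (intro powr_mono) auto
  then have t1: "\<bar>t\<bar> \<le> \<bar>t\<bar> powr r" using False by simp
  have "\<bar>1 + t\<bar> powr r \<le> (2 * \<bar>t\<bar>) powr r"
    using False r by (intro powr_mono2) auto
  also have "\<dots> = 2 powr r * \<bar>t\<bar> powr r" by (simp add: powr_mult)
  also have "\<dots> \<le> r * t + (r + 2 powr r) * \<bar>t\<bar> powr r"
  proof -
    have "r * (- t) \<le> r * \<bar>t\<bar> powr r" using t1 r by (intro mult_left_mono) auto
    then show ?thesis by (simp add: algebra_simps)
  qed
  also have "\<dots> \<le> 1 + r * t + r\<^sup>2 * 2 powr r * (t\<^sup>2 + \<bar>t\<bar> powr r)"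
  proof -
    have g: "2 powr r \<ge> 1" using r by (intro ge_one_powr_ge_zero) auto
    have "r + 2 powr r \<le> r * 2 powr r + r * 2 powr r"
      using mult_left_mono[OF g, of r] mult_right_mono[of 1 r "2 powr r"] r
      by (intro add_mono) auto
    also have "\<dots> = 2 * r * 2 powr r" by simp
    also have "\<dots> \<le> r\<^sup>2 * 2 powr r"
      unfolding power2_eq_square using r by (intro mult_right_mono) auto
    finally have "(r + 2 powr r) * \<bar>t\<bar> powr r \<le> r\<^sup>2 * 2 powr r * \<bar>t\<bar> powr r"
      by (intro mult_right_mono) auto
    also have "\<dots> \<le> r\<^sup>2 * 2 powr r * (t\<^sup>2 + \<bar>t\<bar> powr r)"
      by (intro mult_left_mono) auto
    finally show ?thesis by simp
  qed
  finally show ?thesis .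
qed

definition expansion_const :: "real \<Rightarrow> real" where
  "expansion_const r = r\<^sup>2 * 2 powr r"

lemma expansion_const_ge_1: "r \<ge> 2 \<Longrightarrow> expansion_const r \<ge> 1"
  unfolding expansion_const_def power2_eq_square
  using ge_one_powr_ge_zero[of 2 r] mult_mono[of 1 r 1 r] mult_mono[of 1 "r*r" 1 "2 powr r"] by auto

text \<open>
  The term that is linear in \<open>b\<close> is kept exact, so that it vanishes in expectation when \<open>b\<close> is
  centred and independent of \<open>a\<close>. The usual quadratic term \<open>\<bar>a\<bar> powr (r - 2) * b\<^sup>2\<close> is split between
  the two pure powers; the free weight \<open>\<eta>\<close> decides how, and it will be of order \<open>1 / n\<close> when \<open>b\<close> is
  added to a sum of \<open>n\<close> terms.\<close>
lemma abs_add_powr_le: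
  fixes a b r \<eta> :: real
  assumes r: "r \<ge> 2" and \<eta>: "\<eta> > 0"
  shows "\<bar>a + b\<bar> powr r \<le> (1 + expansion_const r * \<eta>) * \<bar>a\<bar> powr r
           + r * (sgn a * \<bar>a\<bar> powr (r - 1) * b)
           + expansion_const r * (1 + \<eta> powr (1 - r / 2)) * \<bar>b\<bar> powr r"
proof (cases "a = 0")
  case True
  have "1 * 1 \<le> expansion_const r * (1 + \<eta> powr (1 - r / 2))"
    using expansion_const_ge_1[OF r] by (intro mult_mono) auto
  from mult_right_mono[OF this, of "\<bar>b\<bar> powr r"] show ?thesis using True by simp
next
  case False
  define t where "t = b / a"
  define C where "C = expansion_const r"
  have C: "C \<ge> 1" using expansion_const_ge_1[OF r] by (simp add: C_def)
  have b: "b = a * t" using False by (simp add: t_def)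
  \<comment> \<open>Compare \<open>t\<^sup>2\<close> with \<open>\<eta>\<close>: it is dominated by \<open>\<eta>\<close> itself or else by a multiple of \<open>\<bar>t\<bar> powr r\<close>.\<close>
  have sq: "t\<^sup>2 \<le> \<eta> + \<eta> powr (1 - r / 2) * \<bar>t\<bar> powr r"
  proof (cases "t\<^sup>2 \<le> \<eta>")
    case True
    then show ?thesis by (smt (verit) powr_ge_zero mult_nonneg_nonneg)
  next
    case F: False
    then have t: "t \<noteq> 0" using \<eta> by auto
    have "1 \<le> (t\<^sup>2 / \<eta>) powr (r / 2 - 1)"
      using F \<eta> r by (intro ge_one_powr_ge_zero) auto
    also have "\<dots> = \<eta> powr (1 - r / 2) * (t\<^sup>2) powr (r / 2 - 1)"
      using \<eta> t by (simp add: powr_divide powr_diff)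
    finally have "t\<^sup>2 * 1 \<le> t\<^sup>2 * (\<eta> powr (1 - r / 2) * (t\<^sup>2) powr (r / 2 - 1))"
      by (intro mult_left_mono) auto
    also have "\<dots> = \<eta> powr (1 - r / 2) * (t\<^sup>2) powr (r / 2)"
      using t by (simp add: powr_diff)
    also have "(t\<^sup>2) powr (r / 2) = (\<bar>t\<bar> powr 2) powr (r / 2)"
      using t by (simp add: powr_numeral)
    also have "\<dots> = \<bar>t\<bar> powr r" by (simp only: powr_powr) simp
    finally show ?thesis using \<eta> by simp
  qed
  have "\<bar>1 + t\<bar> powr r \<le> 1 + r * t + C * (t\<^sup>2 + \<bar>t\<bar> powr r)"
    using abs_one_plus_powr_le[OF r] unfolding C_def expansion_const_def .
  also have "\<dots> \<le> 1 + r * t + C * ((\<eta> + \<eta> powr (1 - r / 2) * \<bar>t\<bar> powr r) + \<bar>t\<bar> powr r)"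
    using sq C by (intro add_left_mono mult_left_mono add_right_mono) auto
  finally have "\<bar>a\<bar> powr r * \<bar>1 + t\<bar> powr r
      \<le> \<bar>a\<bar> powr r * (1 + r * t + C * ((\<eta> + \<eta> powr (1 - r / 2) * \<bar>t\<bar> powr r) + \<bar>t\<bar> powr r))"
    by (rule mult_left_mono) simp
  moreover have "\<bar>a\<bar> powr r * \<bar>1 + t\<bar> powr r = \<bar>a + b\<bar> powr r"
    by (simp add: powr_mult[symmetric] abs_mult[symmetric] b algebra_simps)
  moreover have "\<bar>a\<bar> powr r * t = sgn a * \<bar>a\<bar> powr (r - 1) * b"
    using False by (simp add: b powr_diff sgn_if)
  moreover have "\<bar>a\<bar> powr r * \<bar>t\<bar> powr r = \<bar>b\<bar> powr r"
    by (simp add: powr_mult[symmetric] abs_mult b)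
  moreover have "\<bar>a\<bar> powr r * (1 + r * t + C * ((\<eta> + \<eta> powr (1 - r / 2) * \<bar>t\<bar> powr r) + \<bar>t\<bar> powr r))
      = (1 + C * \<eta>) * \<bar>a\<bar> powr r + r * (\<bar>a\<bar> powr r * t)
        + C * (1 + \<eta> powr (1 - r / 2)) * (\<bar>a\<bar> powr r * \<bar>t\<bar> powr r)"
    by (simp add: algebra_simps)
  ultimately show ?thesis unfolding C_def[symmetric] by simp
qed

lemma abs_add_powr_le_double:
  fixes a b r :: real
  assumes "r \<ge> 0"
  shows "\<bar>a + b\<bar> powr r \<le> 2 powr r * (\<bar>a\<bar> powr r + \<bar>b\<bar> powr r)"
proof -
  have "\<bar>a + b\<bar> powr r \<le> (2 * max \<bar>a\<bar> \<bar>b\<bar>) powr r"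
    using assms by (intro powr_mono2) auto
  also have "\<dots> = 2 powr r * max \<bar>a\<bar> \<bar>b\<bar> powr r" by (simp add: powr_mult)
  also have "\<dots> \<le> 2 powr r * (\<bar>a\<bar> powr r + \<bar>b\<bar> powr r)"
    by (intro mult_left_mono) (auto simp: max_def)
  finally show ?thesis .
qed

section \<open>Moments of sums of independent variables\<close>
lemma (in finite_measure) integrable_abs_powr_le:
  fixes Z :: "'a \<Rightarrow> real"
  assumes Z: "Z \<in> borel_measurable M" and int: "integrable M (\<lambda>x. \<bar>Z x\<bar> powr r)"
    and s: "0 \<le> s" "s \<le> r"
  shows "integrable M (\<lambda>x. \<bar>Z x\<bar> powr s)"
proof (rule Bochner_Integration.integrable_bound)
  show "integrable M (\<lambda>x. 1 + \<bar>Z x\<bar> powr r)" using int by auto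
  show "(\<lambda>x. \<bar>Z x\<bar> powr s) \<in> borel_measurable M" using Z by measurable
  have "\<bar>z\<bar> powr s \<le> 1 + \<bar>z\<bar> powr r" for z :: real
  proof (cases "\<bar>z\<bar> \<le> 1")
    case True
    have "\<bar>z\<bar> powr s \<le> 1 powr s" using True s by (intro powr_mono2) auto
    then show ?thesis by (simp add: add_increasing2)
  next
    case False
    then have "\<bar>z\<bar> powr s \<le> \<bar>z\<bar> powr r" using s by (intro powr_mono) auto
    then show ?thesis by simp
  qed
  then show "AE x in M. norm (\<bar>Z x\<bar> powr s) \<le> norm (1 + \<bar>Z x\<bar> powr r)"
    by (intro AE_I2) (simp add: add_nonneg_nonneg)
qed

text \<open>Integrating \<open>abs_add_powr_le\<close> leaves no cross term: by independence its expectation is a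
  multiple of \<open>expectation Y = 0\<close>.\<close>
lemma (in prob_space) expectation_abs_add_powr_le:
  fixes S Y :: "'a \<Rightarrow> real"
  assumes r: "r \<ge> 2" and \<eta>: "\<eta> > 0"
    and indep: "indep_var borel Y borel S"
    and intS: "integrable M (\<lambda>x. \<bar>S x\<bar> powr r)"
    and intY: "integrable M (\<lambda>x. \<bar>Y x\<bar> powr r)"
    and mean: "expectation Y = 0"
  shows "integrable M (\<lambda>x. \<bar>S x + Y x\<bar> powr r)"
    and "expectation (\<lambda>x. \<bar>S x + Y x\<bar> powr r)
           \<le> (1 + expansion_const r * \<eta>) * expectation (\<lambda>x. \<bar>S x\<bar> powr r)
             + expansion_const r * (1 + \<eta> powr (1 - r / 2)) * expectation (\<lambda>x. \<bar>Y x\<bar> powr r)"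
proof -
  have S[measurable]: "S \<in> borel_measurable M" and Y[measurable]: "Y \<in> borel_measurable M"
    using indep_var_rv2[OF indep] indep_var_rv1[OF indep] by auto
  show int: "integrable M (\<lambda>x. \<bar>S x + Y x\<bar> powr r)"
  proof (rule Bochner_Integration.integrable_bound)
    show "integrable M (\<lambda>x. 2 powr r * (\<bar>S x\<bar> powr r + \<bar>Y x\<bar> powr r))" using intS intY by auto
    show "AE x in M. norm (\<bar>S x + Y x\<bar> powr r) \<le> norm (2 powr r * (\<bar>S x\<bar> powr r + \<bar>Y x\<bar> powr r))"
      using r by (intro AE_I2) (simp add: abs_add_powr_le_double)
  qed measurable
  define \<psi> :: "real \<Rightarrow> real" where "\<psi> a = sgn a * \<bar>a\<bar> powr (r - 1)" for a
  have [measurable]: "\<psi> \<in> borel_measurable borel" unfolding \<psi>_def by measurable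
  have int\<psi>: "integrable M (\<lambda>x. \<psi> (S x))"
  proof (rule Bochner_Integration.integrable_bound)
    show "integrable M (\<lambda>x. \<bar>S x\<bar> powr (r - 1))"
      using r by (intro integrable_abs_powr_le[OF S intS]) auto
  qed (auto simp: \<psi>_def abs_mult sgn_if)
  have intY1: "integrable M Y"
    using integrable_abs_powr_le[OF Y intY, of 1] r by (simp add: integrable_abs_iff)
  have ind: "indep_var borel Y borel (\<lambda>x. \<psi> (S x))"
    using indep_var_compose[OF indep, of "\<lambda>x. x" borel \<psi> borel] by (simp add: comp_def)
  have cross_int: "integrable M (\<lambda>x. \<psi> (S x) * Y x)"
    using indep_var_integrable[OF ind intY1 int\<psi>] by (simp add: mult.commute)
  have cross: "expectation (\<lambda>x. \<psi> (S x) * Y x) = 0"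
    using indep_var_lebesgue_integral[OF ind intY1 int\<psi>] mean by (simp add: mult.commute)
  let ?C = "expansion_const r"
  have "expectation (\<lambda>x. \<bar>S x + Y x\<bar> powr r)
     \<le> expectation (\<lambda>x. (1 + ?C * \<eta>) * \<bar>S x\<bar> powr r + r * (\<psi> (S x) * Y x)
                       + ?C * (1 + \<eta> powr (1 - r / 2)) * \<bar>Y x\<bar> powr r)"
    unfolding \<psi>_def using int intS intY cross_int[unfolded \<psi>_def]
    by (intro integral_mono abs_add_powr_le r \<eta>) auto
  also have "\<dots> = (1 + ?C * \<eta>) * expectation (\<lambda>x. \<bar>S x\<bar> powr r) + r * expectation (\<lambda>x. \<psi> (S x) * Y x)
                       + ?C * (1 + \<eta> powr (1 - r / 2)) * expectation (\<lambda>x. \<bar>Y x\<bar> powr r)"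
    using intS intY cross_int by simp
  finally show "expectation (\<lambda>x. \<bar>S x + Y x\<bar> powr r)
           \<le> (1 + ?C * \<eta>) * expectation (\<lambda>x. \<bar>S x\<bar> powr r)
             + ?C * (1 + \<eta> powr (1 - r / 2)) * expectation (\<lambda>x. \<bar>Y x\<bar> powr r)"
    using cross by simp
qed

text \<open>This value closes the induction in \<open>sum_moment_le\<close>: half of it pays for the relative increase
  \<open>1 / (2 * n)\<close> of the old sum, and the other half for the new summand.\<close>
definition moment_const :: "real \<Rightarrow> real" where
  "moment_const r = 2 * expansion_const r * (1 + (2 * expansion_const r) powr (r / 2 - 1))"

lemma moment_const_ge: "r \<ge> 2 \<Longrightarrow> moment_const r \<ge> 1"
  using expansion_const_ge_1[of r] mult_mono[of 1 "2 * expansion_const r" 1 "1 + (2 * expansion_const r) powr (r / 2 - 1)"]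
  by (auto simp: moment_const_def)

text \<open>
  A Marcinkiewicz--Zygmund type bound: the \<open>r\<close>-th moment of a centred independent sum grows like
  \<open>n powr (r / 2)\<close>, as it does for Gaussian summands. Adding one summand with the weight
  \<open>\<eta> = 1 / (2 * C * n)\<close> increases the bound by at most \<open>K * B * n powr (r / 2 - 1)\<close>, which is no
  more than the increment of \<open>K * B * n powr (r / 2)\<close>, again by convexity of the power \<open>r / 2 \<ge> 1\<close>.\<close>
lemma (in prob_space) sum_moment_le:
  fixes Y :: "'i \<Rightarrow> 'a \<Rightarrow> real"
  assumes r: "r \<ge> 2" and J: "finite J" and indep: "indep_vars (\<lambda>_. borel) Y J"
    and mean: "\<And>i. i \<in> J \<Longrightarrow> expectation (Y i) = 0"
    and int: "\<And>i. i \<in> J \<Longrightarrow> integrable M (\<lambda>x. \<bar>Y i x\<bar> powr r)"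
    and le: "\<And>i. i \<in> J \<Longrightarrow> expectation (\<lambda>x. \<bar>Y i x\<bar> powr r) \<le> B"
    and B: "B \<ge> 0"
  shows "integrable M (\<lambda>x. \<bar>\<Sum>i\<in>J. Y i x\<bar> powr r) \<and>
         expectation (\<lambda>x. \<bar>\<Sum>i\<in>J. Y i x\<bar> powr r) \<le> moment_const r * B * real (card J) powr (r / 2)"
  using J indep mean int le
proof (induction J rule: finite_induct)
  case empty
  then show ?case by simp
next
  case (insert i J)
  let ?S = "\<lambda>x. \<Sum>i\<in>J. Y i x" and ?C = "expansion_const r" and ?K = "moment_const r"
  let ?n = "real (card J)" and ?A = "expectation (\<lambda>x. \<bar>\<Sum>i\<in>J. Y i x\<bar> powr r)"
  have C: "?C \<ge> 1" using expansion_const_ge_1[OF r] .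
  have IH: "integrable M (\<lambda>x. \<bar>?S x\<bar> powr r)" "?A \<le> ?K * B * ?n powr (r / 2)"
    using insert.IH indep_vars_subset[OF insert.prems(1), of J] insert.prems by auto
  have ind: "indep_var borel (Y i) borel ?S"
    using indep_vars_sum[OF insert.hyps(1,2) insert.prems(1)] .
  note step = expectation_abs_add_powr_le[OF r _ ind IH(1) insert.prems(3)[of i] insert.prems(2)[of i], simplified]
  have eq: "(\<lambda>x. \<bar>\<Sum>i\<in>insert i J. Y i x\<bar> powr r) = (\<lambda>x. \<bar>?S x + Y i x\<bar> powr r)"
    using insert.hyps by (simp add: add.commute)
  have "expectation (\<lambda>x. \<bar>?S x + Y i x\<bar> powr r) \<le> ?K * B * (?n + 1) powr (r / 2)"
  proof (cases "J = {}")
    case True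
    have "expectation (\<lambda>x. \<bar>Y i x\<bar> powr r) \<le> 1 * B" using insert.prems(4)[of i] by simp
    also have "\<dots> \<le> ?K * B" using moment_const_ge[OF r] B by (intro mult_right_mono) auto
    finally show ?thesis using True by simp
  next
    case False
    then have n: "?n \<ge> 1" using insert.hyps by (simp add: Suc_leI card_gt_0_iff)
    define \<eta> where "\<eta> = 1 / (2 * ?C * ?n)"
    have \<eta>: "\<eta> > 0" using C n by (simp add: \<eta>_def)
    have \<eta>p: "\<eta> powr (1 - r / 2) = (2 * ?C) powr (r / 2 - 1) * ?n powr (r / 2 - 1)"
    proof -
      have "\<eta> powr (1 - r / 2) = (2 * ?C * ?n) powr (- (1 - r / 2))"
        unfolding \<eta>_def using C n by (simp only: powr_minus) (simp add: powr_divide inverse_eq_divide)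
      then show ?thesis using C n by (simp add: powr_mult)
    qed
    have n1: "1 \<le> ?n powr (r / 2 - 1)" using n r by (intro ge_one_powr_ge_zero) auto
    have "expectation (\<lambda>x. \<bar>?S x + Y i x\<bar> powr r)
        \<le> (1 + ?C * \<eta>) * ?A + ?C * (1 + \<eta> powr (1 - r / 2)) * expectation (\<lambda>x. \<bar>Y i x\<bar> powr r)"
      by (rule step(2)[OF \<eta>])
    also have "\<dots> \<le> (1 + ?C * \<eta>) * (?K * B * ?n powr (r / 2)) + ?C * (1 + \<eta> powr (1 - r / 2)) * B"
      using IH(2) insert.prems(4)[of i] C \<eta>
      by (intro add_mono mult_left_mono mult_nonneg_nonneg add_nonneg_nonneg) auto
    also have "\<dots> \<le> (1 + ?C * \<eta>) * (?K * B * ?n powr (r / 2))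
                      + ?C * (?n powr (r / 2 - 1) + \<eta> powr (1 - r / 2)) * B"
      using n1 C B by (intro add_left_mono mult_right_mono mult_left_mono) auto
    also have "\<dots> = ?K * B * ?n powr (r / 2) + ?K * B * ?n powr (r / 2 - 1)"
    proof -
      have 1: "?C * \<eta> * ?n powr (r / 2) = ?n powr (r / 2 - 1) / 2"
        using C n by (simp add: \<eta>_def powr_diff)
      have 2: "?C * (?n powr (r / 2 - 1) + \<eta> powr (1 - r / 2)) = ?K / 2 * ?n powr (r / 2 - 1)"
        unfolding \<eta>p moment_const_def by (simp add: algebra_simps)
      have "(1 + ?C * \<eta>) * (?K * B * ?n powr (r / 2))
          = ?K * B * ?n powr (r / 2) + ?K * B * (?C * \<eta> * ?n powr (r / 2))"
        by (simp add: algebra_simps)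
      then show ?thesis unfolding 1 2 by simp
    qed
    also have "\<dots> = ?K * B * (?n powr (r / 2) + 1 * ?n powr (r / 2 - 1) * ((?n + 1) - ?n))"
      by (simp add: algebra_simps)
    also have "\<dots> \<le> ?K * B * (?n powr (r / 2) + (r / 2) * ?n powr (r / 2 - 1) * ((?n + 1) - ?n))"
      using moment_const_ge[OF r] B r by (intro mult_left_mono add_left_mono mult_right_mono) auto
    also have "\<dots> \<le> ?K * B * (?n + 1) powr (r / 2)"
      using moment_const_ge[OF r] B r n powr_ge_tangent[of "r / 2" "?n + 1" ?n]
      by (intro mult_left_mono) auto
    finally show ?thesis .
  qed
  then show ?case unfolding eq using step(1)[of 1] insert.hyps by (simp add: add.commute)
qed

section \<open>Tails of sample averages\<close>

text \<open>Markov's inequality for the \<open>r\<close>-th power of the deviation.\<close>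
lemma (in prob_space) sample_average_tail:
  fixes Z :: "'i \<Rightarrow> 'a \<Rightarrow> 's" and h :: "'s \<Rightarrow> real"
  assumes r: "r \<ge> 2" and J: "finite J" "J \<noteq> {}"
    and indep: "indep_vars (\<lambda>_. D) Z J" and law: "\<And>j. j \<in> J \<Longrightarrow> distr M D (Z j) = D"
    and h: "integrable D h" and mean: "m = (\<integral>s. h s \<partial>D)"
    and int: "integrable D (\<lambda>s. \<bar>h s - m\<bar> powr r)"
    and le: "(\<integral>s. \<bar>h s - m\<bar> powr r \<partial>D) \<le> B"
    and t: "t > 0"
  shows "prob {\<omega> \<in> space M. t \<le> \<bar>(\<Sum>j\<in>J. h (Z j \<omega>)) / real (card J) - m\<bar>}
           \<le> moment_const r * B * real (card J) powr (- (r / 2)) / t powr r"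
proof -
  have [measurable]: "h \<in> borel_measurable D" using h by auto
  have Z: "Z j \<in> measurable M D" if "j \<in> J" for j
    using indep that by (auto simp: indep_vars_def)
  define Y where "Y j \<omega> = h (Z j \<omega>) - m" for j \<omega>
  let ?n = "real (card J)"
  have n: "?n > 0" using J by (simp add: card_gt_0_iff)
  have indepY: "indep_vars (\<lambda>_. borel) Y J"
    unfolding Y_def by (rule indep_vars_compose2[OF indep, of "\<lambda>_ s. h s - m"]) measurable
  have transfer: "integrable M (\<lambda>\<omega>. g (Z j \<omega>)) \<longleftrightarrow> integrable D g"
      "expectation (\<lambda>\<omega>. g (Z j \<omega>)) = (\<integral>s. g s \<partial>D)"
    if "j \<in> J" and [measurable]: "g \<in> borel_measurable D" for j and g :: "'s \<Rightarrow> real"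
    using integrable_distr_eq[OF Z[OF that(1)], of g] integral_distr[OF Z[OF that(1)], of g]
      law[OF that(1)] that(2) by simp_all
  obtain j0 where j0: "j0 \<in> J" using J by auto
  interpret D: prob_space D using prob_space_distr[OF Z[OF j0]] law[OF j0] by simp
  have B: "B \<ge> 0" using le by (rule order_trans[rotated]) (intro integral_nonneg_AE AE_I2, simp)
  have meanY: "expectation (Y j) = 0" if "j \<in> J" for j
    unfolding Y_def using transfer(2)[OF that, of "\<lambda>s. h s - m"] h mean by (simp add: D.prob_space)
  have intY: "integrable M (\<lambda>\<omega>. \<bar>Y j \<omega>\<bar> powr r)"
      and leY: "expectation (\<lambda>\<omega>. \<bar>Y j \<omega>\<bar> powr r) \<le> B" if "j \<in> J" for j
    unfolding Y_def using transfer[OF that, of "\<lambda>s. \<bar>h s - m\<bar> powr r"] int le by simp_all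
  let ?S = "\<lambda>\<omega>. \<Sum>j\<in>J. Y j \<omega>"
  have S: "integrable M (\<lambda>\<omega>. \<bar>?S \<omega>\<bar> powr r)"
      "expectation (\<lambda>\<omega>. \<bar>?S \<omega>\<bar> powr r) \<le> moment_const r * B * ?n powr (r / 2)"
    using sum_moment_le[OF r J(1) indepY meanY intY leY B] by auto
  have dev: "(\<Sum>j\<in>J. h (Z j \<omega>)) / ?n - m = ?S \<omega> / ?n" for \<omega>
    using n by (simp add: Y_def sum_subtractf field_simps)
  have "{\<omega> \<in> space M. t \<le> \<bar>(\<Sum>j\<in>J. h (Z j \<omega>)) / ?n - m\<bar>}
      = {\<omega> \<in> space M. (?n * t) powr r \<le> \<bar>?S \<omega>\<bar> powr r}"
  proof (rule Collect_cong, rule conj_cong[OF refl])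
    fix \<omega>
    have "t \<le> \<bar>(\<Sum>j\<in>J. h (Z j \<omega>)) / ?n - m\<bar> \<longleftrightarrow> ?n * t \<le> \<bar>?S \<omega>\<bar>"
      unfolding dev using n by (simp add: abs_divide field_simps)
    also have "\<dots> \<longleftrightarrow> (?n * t) powr r \<le> \<bar>?S \<omega>\<bar> powr r"
      using n t r powr_mono2[of r "?n * t" "\<bar>?S \<omega>\<bar>"] powr_less_mono2[of r "\<bar>?S \<omega>\<bar>" "?n * t"]
      by fastforce
    finally show "t \<le> \<bar>(\<Sum>j\<in>J. h (Z j \<omega>)) / ?n - m\<bar> \<longleftrightarrow> (?n * t) powr r \<le> \<bar>?S \<omega>\<bar> powr r" .
  qed
  also have "prob \<dots> \<le> expectation (\<lambda>\<omega>. \<bar>?S \<omega>\<bar> powr r) / (?n * t) powr r"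
    by (rule integral_Markov_inequality_measure[OF S(1) sets.empty_sets]) (use n t in auto)
  also have "\<dots> \<le> moment_const r * B * ?n powr (r / 2) / (?n * t) powr r"
    using S(2) by (intro divide_right_mono) auto
  also have "\<dots> = moment_const r * B * ?n powr (- (r / 2)) / t powr r"
  proof -
    have "?n powr (r / 2) / ?n powr r = ?n powr (- (r / 2))" by (simp add: powr_diff[symmetric])
    then show ?thesis using n t
      by (simp add: powr_mult divide_divide_eq_left[symmetric]
          times_divide_eq_right[symmetric] del: times_divide_eq_right divide_divide_eq_left)
  qed
  finally show ?thesis .
qed

section \<open>Conditioning on an independent past\<close>

text \<open>
  The freezing principle: given \<open>H\<close>, the \<open>H\<close>-measurable part of a random event may be treated as a
  constant and only the independent variable \<open>\<Xi>\<close> is averaged. Taking the outcome \<open>\<omega>\<close> itself, seen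
  through \<open>H\<close>, as the frozen quantity covers every \<open>H\<close>-measurable parameter at once.
  Independence says that the joint law of \<open>(\<omega>, \<Xi> \<omega>)\<close> is a product, so the integral of
  the right-hand side over a set of \<open>H\<close> is the probability of the event on that set by Tonelli.\<close>
lemma (in prob_space) real_cond_exp_freeze_independent:
  fixes \<Xi> :: "'a \<Rightarrow> 'b"
  assumes sub: "subalgebra M H" and \<Xi>[measurable]: "\<Xi> \<in> measurable M N"
    and indep: "indep_set (sets H) {\<Xi> -` B \<inter> space M | B. B \<in> sets N}"
    and E: "E \<in> sets (H \<Otimes>\<^sub>M N)"
  shows "AE \<omega> in M. real_cond_exp M H (indicator {\<omega>' \<in> space M. (\<omega>', \<Xi> \<omega>') \<in> E}) \<omega>
           = prob {\<omega>' \<in> space M. (\<omega>, \<Xi> \<omega>') \<in> E}"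
proof -
  interpret finite_measure_subalgebra M H by unfold_locales (rule sub)
  have spH: "space H = space M" and setsH: "sets H \<subseteq> sets M" using sub by (auto simp: subalgebra_def)
  have id[measurable]: "(\<lambda>\<omega>. \<omega>) \<in> measurable M H"
    using setsH spH by (auto simp: measurable_def)
  interpret \<Xi>: prob_space "distr M N \<Xi>" by (rule prob_space_distr) measurable
  interpret id: prob_space "distr M H (\<lambda>\<omega>. \<omega>)" by (rule prob_space_distr) measurable
  have prod: "distr M H (\<lambda>\<omega>. \<omega>) \<Otimes>\<^sub>M distr M N \<Xi> = distr M (H \<Otimes>\<^sub>M N) (\<lambda>\<omega>. (\<omega>, \<Xi> \<omega>))"
  proof (rule pair_measure_eqI)
    fix A B assume "A \<in> sets (distr M H (\<lambda>\<omega>. \<omega>))" "B \<in> sets (distr M N \<Xi>)"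
    then have A: "A \<in> sets H" and B: "B \<in> sets N" by auto
    have "A \<inter> space M = A" using sets.sets_into_space[OF A] spH by auto
    moreover have "(\<lambda>\<omega>. (\<omega>, \<Xi> \<omega>)) -` (A \<times> B) \<inter> space M = A \<inter> (\<Xi> -` B \<inter> space M)"
      using sets.sets_into_space[OF A] spH by auto
    moreover have "prob (A \<inter> (\<Xi> -` B \<inter> space M)) = prob A * prob (\<Xi> -` B \<inter> space M)"
      using A B by (intro indep_setD[OF indep]) auto
    ultimately show "emeasure (distr M H (\<lambda>\<omega>. \<omega>)) A * emeasure (distr M N \<Xi>) B
        = emeasure (distr M (H \<Otimes>\<^sub>M N) (\<lambda>\<omega>. (\<omega>, \<Xi> \<omega>))) (A \<times> B)"
      using A B by (simp add: emeasure_distr emeasure_eq_measure ennreal_mult)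
  qed (simp_all cong: sets_pair_measure_cong, unfold_locales)
  define g where "g \<omega> = prob {\<omega>' \<in> space M. (\<omega>, \<Xi> \<omega>') \<in> E}" for \<omega>
  have g01: "0 \<le> g \<omega>" "g \<omega> \<le> 1" for \<omega> by (simp_all add: g_def)
  have slice: "emeasure (distr M N \<Xi>) (Pair \<omega> -` E) = ennreal (g \<omega>)" for \<omega>
  proof -
    have "emeasure (distr M N \<Xi>) (Pair \<omega> -` E) = emeasure M (\<Xi> -` (Pair \<omega> -` E) \<inter> space M)"
      using E by (intro emeasure_distr) (auto intro: sets_Pair1)
    also have "\<Xi> -` (Pair \<omega> -` E) \<inter> space M = {\<omega>' \<in> space M. (\<omega>, \<Xi> \<omega>') \<in> E}" by auto
    finally show ?thesis by (simp add: g_def emeasure_eq_measure)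
  qed
  have E': "E \<in> sets (H \<Otimes>\<^sub>M distr M N \<Xi>)" using E by (simp cong: sets_pair_measure_cong)
  have gH: "g \<in> borel_measurable H"
  proof -
    have "(\<lambda>\<omega>. enn2real (emeasure (distr M N \<Xi>) (Pair \<omega> -` E))) \<in> borel_measurable H"
      using \<Xi>.measurable_emeasure_Pair[OF E'] by measurable
    then show ?thesis unfolding slice by (simp add: g_def[abs_def])
  qed
  then have [measurable]: "g \<in> borel_measurable M"
    using measurable_from_subalg[OF sub] by blast
  let ?A = "{\<omega>' \<in> space M. (\<omega>', \<Xi> \<omega>') \<in> E}"
  have A[measurable]: "?A \<in> sets M"
  proof -
    have "(\<lambda>\<omega>. (\<omega>, \<Xi> \<omega>)) -` E \<inter> space M \<in> sets M"
      using E by (intro measurable_sets[of _ M "H \<Otimes>\<^sub>M N"]) measurable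
    moreover have "(\<lambda>\<omega>. (\<omega>, \<Xi> \<omega>)) -` E \<inter> space M = ?A" by auto
    ultimately show ?thesis by simp
  qed
  have "AE \<omega> in M. real_cond_exp M H (indicator ?A) \<omega> = g \<omega>"
  proof (rule real_cond_exp_charact)
    show "integrable M (indicator ?A :: 'a \<Rightarrow> real)"
      by (rule integrable_real_indicator[OF A]) (simp add: emeasure_eq_measure)
    show "integrable M g"
      by (rule integrable_const_bound[of _ 1]) (auto simp: g_def)
    show "g \<in> borel_measurable H" by (rule gH)
    fix C assume C: "C \<in> sets H"
    then have [measurable]: "C \<in> sets M" using setsH by auto
    have EC: "E \<inter> (C \<times> space N) \<in> sets (H \<Otimes>\<^sub>M N)" using E C by auto
    have "ennreal (\<integral>\<omega>\<in>C. indicator ?A \<omega> \<partial>M) = emeasure M (?A \<inter> C)"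
    proof -
      have "(\<integral>\<omega>\<in>C. (indicator ?A \<omega> :: real) \<partial>M) = (\<integral>\<omega>. indicator (?A \<inter> C) \<omega> \<partial>M)"
        unfolding set_lebesgue_integral_def by (intro Bochner_Integration.integral_cong) (auto simp: indicator_def)
      then show ?thesis by (simp add: emeasure_eq_measure)
    qed
    also have "?A \<inter> C = (\<lambda>\<omega>. (\<omega>, \<Xi> \<omega>)) -` (E \<inter> (C \<times> space N)) \<inter> space M"
      using measurable_space[OF \<Xi>] by auto
    also have "emeasure M \<dots> = emeasure (distr M (H \<Otimes>\<^sub>M N) (\<lambda>\<omega>. (\<omega>, \<Xi> \<omega>))) (E \<inter> (C \<times> space N))"
      by (rule emeasure_distr[symmetric, OF _ EC]) measurable
    also have "\<dots> = (\<integral>\<^sup>+\<omega>. emeasure (distr M N \<Xi>) (Pair \<omega> -` (E \<inter> (C \<times> space N))) \<partial>distr M H (\<lambda>\<omega>. \<omega>))"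
      unfolding prod[symmetric]
      using EC by (intro \<Xi>.emeasure_pair_measure_alt) (simp cong: sets_pair_measure_cong)
    also have "\<dots> = (\<integral>\<^sup>+\<omega>. ennreal (indicator C \<omega> * g \<omega>) \<partial>distr M H (\<lambda>\<omega>. \<omega>))"
    proof (rule nn_integral_cong)
      fix \<omega>
      have "Pair \<omega> -` (E \<inter> (C \<times> space N)) = (if \<omega> \<in> C then Pair \<omega> -` E else {})"
        using sets.sets_into_space[OF E] by (auto simp: space_pair_measure)
      then show "emeasure (distr M N \<Xi>) (Pair \<omega> -` (E \<inter> (C \<times> space N))) = ennreal (indicator C \<omega> * g \<omega>)"
        by (simp add: slice)
    qed
    also have "\<dots> = (\<integral>\<^sup>+\<omega>. ennreal (indicator C \<omega> * g \<omega>) \<partial>M)"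
      using gH C by (intro nn_integral_distr) auto
    also have "\<dots> = ennreal (\<integral>\<omega>\<in>C. g \<omega> \<partial>M)"
      unfolding set_lebesgue_integral_def real_scaleR_def
    proof (rule nn_integral_eq_integral)
      show "integrable M (\<lambda>\<omega>. indicator C \<omega> * g \<omega>)"
        by (rule integrable_const_bound[of _ 1]) (auto simp: g01 indicator_def split: if_splits)
    qed (simp add: g01)
    finally show "(\<integral>\<omega>\<in>C. indicator ?A \<omega> \<partial>M) = (\<integral>\<omega>\<in>C. g \<omega> \<partial>M)"
      by (subst (asm) ennreal_inj)
         (auto simp: set_lebesgue_integral_def g_def intro!: integral_nonneg_AE)
  qed
  then show ?thesis unfolding g_def .
qed

section \<open>Measurability with respect to the past\<close>
lemma rv_events_subset_Pow: "rv_events M N Z I \<subseteq> Pow (space M)"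
  by (auto simp: rv_events_def)

lemma rv_events_mono: "I \<subseteq> J \<Longrightarrow> rv_events M N Z I \<subseteq> rv_events M N Z J"
  unfolding rv_events_def by (rule UN_mono) auto

lemma rv_events_subset_sets:
  assumes "\<And>i. i \<in> I \<Longrightarrow> Z i \<in> measurable M N"
  shows "rv_events M N Z I \<subseteq> sets M"
  using assms by (auto simp: rv_events_def)

lemma measurable_sigma_rv_events:
  assumes "rv_events M N Z I \<subseteq> \<S>" "\<S> \<subseteq> Pow (space M)" "i \<in> I"
    and "Z i \<in> space M \<rightarrow> space N"
  shows "Z i \<in> measurable (sigma (space M) \<S>) N"
proof (rule measurableI)
  show "Z i \<omega> \<in> space N" if "\<omega> \<in> space (sigma (space M) \<S>)" for \<omega>
    using assms that by (auto simp: space_measure_of)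
  fix A assume "A \<in> sets N"
  then have "Z i -` A \<inter> space M \<in> \<S>" using assms(1,3) by (auto simp: rv_events_def)
  then show "Z i -` A \<inter> space (sigma (space M) \<S>) \<in> sets (sigma (space M) \<S>)"
    using assms(2) by (simp add: space_measure_of)
qed

text \<open>The family \<open>Z\<close>, bundled into one variable with values in a product space, generates no events
  beyond those generated by its members. If the family is independent of some \<open>\<sigma>\<close>-algebra, then so is
  the bundled variable, and the freezing principle applies to it.\<close>
lemma preimages_restrict_subset_sigma_rv_events:
  assumes Z: "\<And>i. i \<in> I \<Longrightarrow> Z i \<in> measurable M N"
  shows "{(\<lambda>\<omega>. \<lambda>i\<in>I. Z i \<omega>) -` B \<inter> space M | B. B \<in> sets (PiM I (\<lambda>_. N))}
           \<subseteq> sigma_sets (space M) (rv_events M N Z I)"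
proof safe
  fix B assume "B \<in> sets (PiM I (\<lambda>_. N))"
  have "(\<lambda>\<omega>. \<lambda>i\<in>I. Z i \<omega>) \<in> measurable (sigma (space M) (rv_events M N Z I)) (PiM I (\<lambda>_. N))"
    using Z by (intro measurable_restrict measurable_sigma_rv_events[where I = I] rv_events_subset_Pow)
      (auto simp: measurable_def)
  from measurable_sets[OF this \<open>B \<in> _\<close>]
  show "(\<lambda>\<omega>. \<lambda>i\<in>I. Z i \<omega>) -` B \<inter> space M \<in> sigma_sets (space M) (rv_events M N Z I)"
    by (simp add: rv_events_subset_Pow space_measure_of)
qed

lemma space_past_algebra [simp]: "space (past_algebra M G Fe Fg k) = space M"
  by (simp add: past_algebra_def space_measure_of rv_events_subset_Pow)

lemma sets_past_algebra:
  "sets (past_algebra M G Fe Fg k) = sigma_sets (space M)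
     (rv_events M borel Fe {..<k} \<union> rv_events M borel Fg {..<k} \<union> rv_events M borel G {..k})"
  by (simp add: past_algebra_def rv_events_subset_Pow)

context stochastic_dfo
begin

lemma subalgebra_past: "subalgebra M (past_algebra M G Fe Fg k)"
  unfolding subalgebra_def sets_past_algebra
  by (intro conjI space_past_algebra sets.sigma_sets_subset Un_least rv_events_subset_sets
      G_measurable Fe_measurable Fg_measurable)

lemma measurable_past:
  "j < k \<Longrightarrow> Fe j \<in> borel_measurable (past_algebra M G Fe Fg k)"
  "j < k \<Longrightarrow> Fg j \<in> borel_measurable (past_algebra M G Fe Fg k)"
  "j \<le> k \<Longrightarrow> G j \<in> borel_measurable (past_algebra M G Fe Fg k)"
  unfolding past_algebra_def
  by (rule measurable_sigma_rv_events[where Z = Fe and I = "{..<k}"]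
        measurable_sigma_rv_events[where Z = Fg and I = "{..<k}"]
        measurable_sigma_rv_events[where Z = G and I = "{..k}"];
      simp add: rv_events_subset_Pow le_supI1)+

lemma subalgebra_past_Suc:
  "subalgebra (past_algebra M G Fe Fg (Suc k)) (past_algebra M G Fe Fg k)"
  unfolding subalgebra_def sets_past_algebra
  by (intro conjI sigma_sets_mono' Un_mono rv_events_mono) auto

text \<open>The start is deterministic, and each update is a Borel function of the previous iterate, stepsize,
  direction and estimates, which have all entered the past by the next iteration.\<close>
lemma iterate_measurable_past:
  "X k \<in> borel_measurable (past_algebra M G Fe Fg k) \<and>
   \<Delta> k \<in> borel_measurable (past_algebra M G Fe Fg k)"
proof (induction k)
  case 0
  obtain x0 \<delta>0 where *: "\<forall>\<omega>\<in>space M. X 0 \<omega> = x0 \<and> \<Delta> 0 \<omega> = \<delta>0"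
    using init_deterministic by blast
  then show ?case
    using measurable_cong[of "past_algebra M G Fe Fg 0" "X 0" "\<lambda>_. x0" borel]
      measurable_cong[of "past_algebra M G Fe Fg 0" "\<Delta> 0" "\<lambda>_. \<delta>0" borel] by simp
next
  case (Suc k)
  let ?H = "past_algebra M G Fe Fg (Suc k)"
  obtain U where U: "U \<in> borel \<rightarrow>\<^sub>M borel"
    and eq: "\<And>\<omega>. \<omega> \<in> space M \<Longrightarrow>
        (X (Suc k) \<omega>, \<Delta> (Suc k) \<omega>) = U (X k \<omega>, \<Delta> k \<omega>, G k \<omega>, Fe k \<omega>, Fg k \<omega>)"
    using update[of k] by blast
  have X: "X k \<in> borel_measurable ?H" and D: "\<Delta> k \<in> borel_measurable ?H"
    using Suc measurable_from_subalg[OF subalgebra_past_Suc] by blast+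
  have "(\<lambda>\<omega>. (X k \<omega>, \<Delta> k \<omega>, G k \<omega>, Fe k \<omega>, Fg k \<omega>)) \<in> borel_measurable ?H"
    by (intro borel_measurable_Pair X D measurable_past) auto
  from measurable_compose[OF this U]
  have UH: "(\<lambda>\<omega>. U (X k \<omega>, \<Delta> k \<omega>, G k \<omega>, Fe k \<omega>, Fg k \<omega>)) \<in> borel_measurable ?H" .
  have "(\<lambda>\<omega>. (X (Suc k) \<omega>, \<Delta> (Suc k) \<omega>)) \<in> borel_measurable ?H"
    using UH by (subst measurable_cong[OF eq]) auto
  then have H: "(\<lambda>\<omega>. (X (Suc k) \<omega>, \<Delta> (Suc k) \<omega>)) \<in> measurable ?H (borel \<Otimes>\<^sub>M borel)"
    by (simp add: borel_prod)
  show ?case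
    using measurable_compose[OF H measurable_fst] measurable_compose[OF H measurable_snd] by simp
qed

end

section \<open>Sample averages with a random number of samples\<close>

text \<open>The upper limit of the sum is itself a measurable function; it has countably many values, and
  for each fixed value the sum is measurable.\<close>
lemma borel_measurable_sample_average:
  fixes F :: "'b::second_countable_topology \<Rightarrow> 's \<Rightarrow> real" and p :: "real \<Rightarrow> nat"
  assumes F: "(\<lambda>(x, s). F x s) \<in> borel_measurable (borel \<Otimes>\<^sub>M D)"
    and x: "x \<in> borel_measurable L" and \<delta>: "\<delta> \<in> borel_measurable L"
    and p: "p \<in> measurable borel (count_space UNIV)"
    and s: "\<And>i. i \<ge> 1 \<Longrightarrow> s i \<in> measurable L D"
  shows "(\<lambda>z. (\<Sum>i = 1..p (\<delta> z). F (x z) (s i z)) / real (p (\<delta> z))) \<in> borel_measurable L"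
proof (rule measurable_compose_countable[where g = "\<lambda>z. p (\<delta> z)" 
      and f = "\<lambda>n z. (\<Sum>i = 1..n. F (x z) (s i z)) / real n"])
  show "(\<lambda>z. p (\<delta> z)) \<in> measurable L (count_space UNIV)"
    using measurable_compose[OF \<delta> p] .
  fix n :: nat
  have "(\<lambda>z. F (x z) (s i z)) \<in> borel_measurable L" if "i \<in> {1..n}" for i
    using measurable_compose[OF measurable_Pair[OF x s] F, of i] that by simp
  then show "(\<lambda>z. (\<Sum>i = 1..n. F (x z) (s i z)) / real n) \<in> borel_measurable L"
    by (intro borel_measurable_divide borel_measurable_sum) auto
qed

text \<open>Rounding up costs at most \<open>1\<close>, which is no more than 
  \<open>\<delta> powr (- b)\<close> for \<open>\<delta> < 1\<close>.\<close>
lemma sample_size_bigo: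
  assumes "b \<ge> 0"
  shows "(\<lambda>\<delta>. real (nat \<lceil>\<delta> powr (- b)\<rceil>)) \<in> O[at_right 0](\<lambda>\<delta>. \<delta> powr (- b))"
proof (rule bigoI[where c = 2])
  have "eventually (\<lambda>\<delta>::real. \<delta> \<in> {0<..<1}) (at_right 0)"
    by (rule eventually_at_right_real) simp
  then show "eventually (\<lambda>\<delta>. norm (real (nat \<lceil>\<delta> powr (- b)\<rceil>)) \<le> 2 * norm (\<delta> powr (- b))) (at_right 0)"
  proof eventually_elim
    case (elim \<delta>)
    have "\<delta> powr b \<le> 1 powr b" using elim assms by (intro powr_mono2) auto
    then have "1 \<le> \<delta> powr (- b)" using elim by (simp add: powr_minus one_le_inverse_iff)
    moreover have "real (nat \<lceil>\<delta> powr (- b)\<rceil>) \<le> \<delta> powr (- b) + 1"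
      using real_nat_ceiling_ge[of "\<delta> powr (- b)"] of_int_ceiling_le_add_one[of "\<delta> powr (- b)"]
      by (simp add: le_ceiling_iff)
    ultimately have "real (nat \<lceil>\<delta> powr (- b)\<rceil>) \<le> 2 * \<delta> powr (- b)" by linarith
    then show ?case
      by (simp only: real_norm_def abs_of_nonneg[OF of_nat_0_le_iff] abs_of_nonneg[OF powr_ge_zero])
  qed
qed

text \<open>
  If the difference of the two averages is off by \<open>t\<close>, then one of the averages is off by \<open>t / 2\<close>;
  this accounts for the factor \<open>2 * 2 powr r\<close>.\<close>
lemma (in prob_space) two_sample_averages_tail:
  fixes F :: "'b \<Rightarrow> 's \<Rightarrow> real" and Z :: "nat + nat \<Rightarrow> 'a \<Rightarrow> 's"
  assumes r: "r \<ge> 2"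
    and indep: "indep_vars (\<lambda>_. D) Z ({1..} <+> {1..})"
    and law: "\<And>j. j \<in> {1..} <+> {1..} \<Longrightarrow> distr M D (Z j) = D"
    and F: "\<And>x. integrable D (F x)" and f: "\<And>x. f x = (\<integral>s. F x s \<partial>D)"
    and int: "\<And>x. integrable D (\<lambda>s. \<bar>F x s - f x\<bar> powr r)"
    and le: "\<And>x. (\<integral>s. \<bar>F x s - f x\<bar> powr r \<partial>D) \<le> B"
    and n: "n \<ge> 1" and t: "t > 0"
  shows "prob {\<omega> \<in> space M. t \<le> \<bar>(\<Sum>i = 1..n. F x (Z (Inl i) \<omega>)) / real n
             - (\<Sum>i = 1..n. F y (Z (Inr i) \<omega>)) / real n - (f x - f y)\<bar>}
          \<le> 2 * 2 powr r * moment_const r * B * real n powr (- (r / 2)) / t powr r"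
proof -
  have Z: "Z j \<in> measurable M D" if "j \<in> {1..} <+> {1..}" for j
    using indep that by (auto simp: indep_vars_def)
  have [measurable]: "F x \<in> borel_measurable D" for x using F[of x] by auto
  have meas: "(\<lambda>\<omega>. F x (Z (Inl i) \<omega>)) \<in> borel_measurable M"
    "(\<lambda>\<omega>. F x (Z (Inr i) \<omega>)) \<in> borel_measurable M" if "i \<in> {1..n}" for i x
    using that by (auto intro!: measurable_compose[OF Z])
  let ?P = "\<lambda>\<omega>. \<bar>(\<Sum>i = 1..n. F x (Z (Inl i) \<omega>)) / real n - f x\<bar>"
  let ?Q = "\<lambda>\<omega>. \<bar>(\<Sum>i = 1..n. F y (Z (Inr i) \<omega>)) / real n - f y\<bar>"
  have P[measurable]: "?P \<in> borel_measurable M" and Q[measurable]: "?Q \<in> borel_measurable M"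
    using meas by (auto intro!: borel_measurable_abs borel_measurable_diff borel_measurable_divide borel_measurable_sum)
  let ?c = "moment_const r * B * real n powr (- (r / 2)) / (t / 2) powr r"
  have one: "prob {\<omega> \<in> space M. t / 2 \<le> ?P \<omega>} \<le> ?c"
  proof -
    have sub: "Inl ` {1..n} \<subseteq> {1..} <+> {1..}" by auto
    have "prob {\<omega> \<in> space M. t / 2 \<le> \<bar>(\<Sum>j\<in>Inl ` {1..n}. F x (Z j \<omega>)) / real (card (Inl ` {1..n} :: (nat + nat) set)) - f x\<bar>}
        \<le> moment_const r * B * real (card (Inl ` {1..n} :: (nat + nat) set)) powr (- (r / 2)) / (t / 2) powr r"
      by (rule sample_average_tail[OF r _ _ indep_vars_subset[OF indep sub] law[OF subsetD[OF sub]] F f int le])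
         (use n t in auto)
    then show ?thesis by (simp add: sum.reindex card_image)
  qed
  have two: "prob {\<omega> \<in> space M. t / 2 \<le> ?Q \<omega>} \<le> ?c"
  proof -
    have sub: "Inr ` {1..n} \<subseteq> {1..} <+> {1..}" by auto
    have "prob {\<omega> \<in> space M. t / 2 \<le> \<bar>(\<Sum>j\<in>Inr ` {1..n}. F y (Z j \<omega>)) / real (card (Inr ` {1..n} :: (nat + nat) set)) - f y\<bar>}
        \<le> moment_const r * B * real (card (Inr ` {1..n} :: (nat + nat) set)) powr (- (r / 2)) / (t / 2) powr r"
      by (rule sample_average_tail[OF r _ _ indep_vars_subset[OF indep sub] law[OF subsetD[OF sub]] F f int le])
         (use n t in auto)
    then show ?thesis by (simp add: sum.reindex card_image)
  qed
  have "prob {\<omega> \<in> space M. t \<le> \<bar>(\<Sum>i = 1..n. F x (Z (Inl i) \<omega>)) / real n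
             - (\<Sum>i = 1..n. F y (Z (Inr i) \<omega>)) / real n - (f x - f y)\<bar>}
      \<le> prob ({\<omega> \<in> space M. t / 2 \<le> ?P \<omega>} \<union> {\<omega> \<in> space M. t / 2 \<le> ?Q \<omega>})"
  proof (rule finite_measure_mono)
    have "t / 2 \<le> \<bar>a - c\<bar> \<or> t / 2 \<le> \<bar>b - d\<bar>" if "t \<le> \<bar>a - b - (c - d)\<bar>" for a b c d :: real
      using that by linarith
    then show "{\<omega> \<in> space M. t \<le> \<bar>(\<Sum>i = 1..n. F x (Z (Inl i) \<omega>)) / real n
             - (\<Sum>i = 1..n. F y (Z (Inr i) \<omega>)) / real n - (f x - f y)\<bar>}
        \<subseteq> {\<omega> \<in> space M. t / 2 \<le> ?P \<omega>} \<union> {\<omega> \<in> space M. t / 2 \<le> ?Q \<omega>}" by blast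
  qed measurable
  also have "\<dots> \<le> prob {\<omega> \<in> space M. t / 2 \<le> ?P \<omega>} + prob {\<omega> \<in> space M. t / 2 \<le> ?Q \<omega>}"
    by (rule measure_Un_le) measurable
  also have "\<dots> \<le> 2 * ?c" using add_mono[OF one two] by (simp only: mult_2)
  also have "\<dots> = 2 * 2 powr r * moment_const r * B * real n powr (- (r / 2)) / t powr r"
    using t by (simp add: powr_divide)
  finally show ?thesis .
qed

section \<open>The tail bound condition\<close>
theorem corollary2p5:
  fixes f :: "real^'n \<Rightarrow> real"
    and fstar \<epsilon> q r Mr :: real
    and D :: "'s measure"
    and F :: "real^'n \<Rightarrow> 's \<Rightarrow> real"
  assumes f_lipschitz: "locally_lipschitz f"
    and f_bdd: "bdd_below (range f)"
    and f_inf: "(INF x. f x) = fstar"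
    and D_prob: "prob_space D"
    and F_measurable: "(\<lambda>(x, s). F x s) \<in> borel_measurable (borel \<Otimes>\<^sub>M D)"
    and eps: "0 < \<epsilon>" "\<epsilon> \<le> 2"
    and q_def: "q = 1 + \<epsilon> / 2"
    and r_def: "r = q / (q - 1)"
    and unbiased: "\<And>x. integrable D (F x)" "\<And>x. f x = (\<integral>s. F x s \<partial>D)"
    and moment: "\<And>x. integrable D (\<lambda>s. \<bar>F x s - f x\<bar> powr r)"
      "\<And>x. (\<integral>s. \<bar>F x s - f x\<bar> powr r \<partial>D) \<le> Mr"
  shows "\<exists>(p :: real \<Rightarrow> nat) (\<epsilon>q :: real).
           (\<forall>\<delta>>0. p \<delta> \<ge> 1) \<and>
           (\<lambda>\<delta>. real (p \<delta>)) \<in> O[at_right 0](\<lambda>\<delta>. \<delta> powr (- 2 - \<epsilon>)) \<and>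
           \<epsilon>q > 0 \<and>
           (\<forall>(M :: 'w measure) (X :: nat \<Rightarrow> 'w \<Rightarrow> real^'n) (\<Delta> :: nat \<Rightarrow> 'w \<Rightarrow> real)
              (G :: nat \<Rightarrow> 'w \<Rightarrow> real^'n) (Fe :: nat \<Rightarrow> 'w \<Rightarrow> real) (Fg :: nat \<Rightarrow> 'w \<Rightarrow> real)
              (\<xi> :: nat \<Rightarrow> nat \<Rightarrow> 'w \<Rightarrow> 's) (\<xi>g :: nat \<Rightarrow> nat \<Rightarrow> 'w \<Rightarrow> 's).
              stochastic_dfo M X \<Delta> G Fe Fg \<longrightarrow>
              sample_averages M D F p X \<Delta> G Fe Fg \<xi> \<xi>g \<longrightarrow>
              tail_bound M f X \<Delta> G Fe Fg q \<epsilon>q)"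
proof -
  define b where "b = 2 + \<epsilon>"
  \<comment> \<open>The exponent \<open>b = 2 * q\<close> makes the typical error \<open>p \<delta> powr (- 1 / 2)\<close> of an average at most
      \<open>\<delta> powr q\<close>, the scale of the tail bound condition.\<close>
  define p where "p \<delta> = nat \<lceil>\<delta> powr (- b)\<rceil>" for \<delta> :: real
  \<comment> \<open>The maximum with \<open>1\<close> keeps the constant positive when \<open>Mr = 0\<close>.\<close>
  define \<epsilon>q where "\<epsilon>q = 2 * 2 powr r * moment_const r * max Mr 1"
  have b: "b > 0" "- 2 - \<epsilon> = - b" "b = 2 * q" using eps by (auto simp: b_def q_def)
  have r: "r \<ge> 2" using eps by (simp add: r_def q_def field_simps)
  have K: "moment_const r \<ge> 1" using moment_const_ge[OF r] .
  have p_ge: "p \<delta> \<ge> 1" if "\<delta> > 0" for \<delta>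
  proof -
    have "\<delta> powr (- b) > 0" using that by simp
    then show ?thesis unfolding p_def by linarith
  qed
  have p_meas: "p \<in> measurable borel (count_space UNIV)"
    unfolding p_def by measurable
  have p_bigo: "(\<lambda>\<delta>. real (p \<delta>)) \<in> O[at_right 0](\<lambda>\<delta>. \<delta> powr (- 2 - \<epsilon>))"
    unfolding p_def b(2) using b(1) by (intro sample_size_bigo) simp
  have \<epsilon>q_pos: "\<epsilon>q > 0" using K by (simp add: \<epsilon>q_def)
  have f_meas: "f \<in> borel_measurable borel"
  proof -
    interpret D: prob_space D by (rule D_prob)
    have "(\<lambda>x. \<integral>s. F x s \<partial>D) \<in> borel_measurable borel"
      using F_measurable by (intro D.borel_measurable_lebesgue_integral) 
    then show ?thesis using unbiased(2) by (simp add: fun_eq_iff[symmetric] cong: measurable_cong)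
  qed
  have "tail_bound M f X \<Delta> G Fe Fg q \<epsilon>q"
    if dfo: "stochastic_dfo M X \<Delta> G Fe Fg" and sa: "sample_averages M D F p X \<Delta> G Fe Fg \<xi> \<xi>g"
    for M :: "'w measure" and X \<Delta> G Fe Fg \<xi> \<xi>g
    unfolding tail_bound_def
  proof (intro allI impI)
    fix k :: nat and \<alpha> :: real assume \<alpha>: "\<alpha> > 0"
    interpret stochastic_dfo M X \<Delta> G Fe Fg by (rule dfo)
    define I where "I = {1::nat..} <+> {1::nat..}"
    have in_I [simp]: "Inl i \<in> I \<longleftrightarrow> Suc 0 \<le> i" "Inr i \<in> I \<longleftrightarrow> Suc 0 \<le> i" for i
      by (auto simp: I_def)
    define Z where "Z = case_sum (\<xi> k) (\<xi>g k)"
    let ?H = "past_algebra M G Fe Fg k"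
    let ?N = "PiM I (\<lambda>_. D)"
    define \<Xi> where "\<Xi> = (\<lambda>\<omega>. \<lambda>i\<in>I. Z i \<omega>)"
    have sums: "(\<Sum>i = 1..n. F x (\<Xi> \<omega> (Inl i))) = (\<Sum>i = 1..n. F x (Z (Inl i) \<omega>))"
      "(\<Sum>i = 1..n. F x (\<Xi> \<omega> (Inr i))) = (\<Sum>i = 1..n. F x (Z (Inr i) \<omega>))" for n x \<omega>
      by (auto simp: \<Xi>_def intro!: sum.cong)
    have indepZ: "indep_vars (\<lambda>_. D) Z I"
      and lawZ: "\<And>j. j \<in> I \<Longrightarrow> distr M D (Z j) = D"
      and past: "indep_set (sets ?H) (sigma_sets (space M) (rv_events M D Z I))"
      and Fe_eq: "\<And>\<omega>. \<omega> \<in> space M \<Longrightarrow>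
        Fe k \<omega> = (\<Sum>i = 1..p (\<Delta> k \<omega>). F (X k \<omega>) (\<xi> k i \<omega>)) / real (p (\<Delta> k \<omega>))"
      and Fg_eq: "\<And>\<omega>. \<omega> \<in> space M \<Longrightarrow>
        Fg k \<omega> = (\<Sum>i = 1..p (\<Delta> k \<omega>). F (X k \<omega> + \<Delta> k \<omega> *\<^sub>R G k \<omega>) (\<xi>g k i \<omega>))
                 / real (p (\<Delta> k \<omega>))"
      using sa unfolding sample_averages_def I_def Z_def by auto
    have Z: "Z j \<in> measurable M D" if "j \<in> I" for j
      using indepZ that by (auto simp: indep_vars_def)
    have \<Xi>_meas: "\<Xi> \<in> measurable M ?N" unfolding \<Xi>_def using Z by (intro measurable_restrict)
    have indep: "indep_set (sets ?H) {\<Xi> -` B \<inter> space M | B. B \<in> sets ?N}"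
      unfolding indep_set_def \<Xi>_def
      by (rule indep_sets_mono_sets[OF past[unfolded indep_set_def]])
         (use preimages_restrict_subset_sigma_rv_events[where Z = Z and I = I and M = M and N = D, OF Z] in \<open>auto split: bool.splits\<close>)
    \<comment> \<open>The estimation error as a function of the outcome, through which the past enters, and of a
        separate sequence of samples.\<close>
    define dev where "dev = (\<lambda>(\<omega>, s).
        \<bar>(\<Sum>i = 1..p (\<Delta> k \<omega>). F (X k \<omega>) (s (Inl i))) / real (p (\<Delta> k \<omega>))
         - (\<Sum>i = 1..p (\<Delta> k \<omega>). F (X k \<omega> + \<Delta> k \<omega> *\<^sub>R G k \<omega>) (s (Inr i))) / real (p (\<Delta> k \<omega>))
         - (f (X k \<omega>) - f (X k \<omega> + \<Delta> k \<omega> *\<^sub>R G k \<omega>))\<bar>)"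
    let ?L = "?H \<Otimes>\<^sub>M ?N"
    define E where "E = {z \<in> space ?L. \<alpha> * \<Delta> k (fst z) powr q \<le> dev z}"
    have E: "E \<in> sets ?L"
    proof -
      have X: "(\<lambda>z. X k (fst z)) \<in> borel_measurable ?L"
        and \<Delta>[measurable]: "(\<lambda>z. \<Delta> k (fst z)) \<in> borel_measurable ?L"
        and Gk: "(\<lambda>z. G k (fst z)) \<in> borel_measurable ?L"
        using iterate_measurable_past[of k] measurable_past(3)[of k k]
        by (auto intro: measurable_compose[OF measurable_fst])
      have Y: "(\<lambda>z. X k (fst z) + \<Delta> k (fst z) *\<^sub>R G k (fst z)) \<in> borel_measurable ?L"
        using X \<Delta> Gk by measurable
      have s: "(\<lambda>z. snd z j) \<in> measurable ?L D" if "j \<in> I" for j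
        using that by (intro measurable_compose[OF measurable_snd measurable_component_singleton])
      have "dev \<in> borel_measurable ?L"
        unfolding dev_def case_prod_beta'
        by (intro borel_measurable_abs borel_measurable_diff
            borel_measurable_sample_average[OF F_measurable _ _ p_meas]
            X \<Delta> Y s measurable_compose[OF _ f_meas]) (auto simp: I_def)
      then show ?thesis unfolding E_def by measurable
    qed
    have event: "{\<omega>' \<in> space M.
             \<bar>Fe k \<omega>' - Fg k \<omega>' - (f (X k \<omega>') - f (X k \<omega>' + \<Delta> k \<omega>' *\<^sub>R G k \<omega>'))\<bar>
               \<ge> \<alpha> * \<Delta> k \<omega>' powr q} = {\<omega>' \<in> space M. (\<omega>', \<Xi> \<omega>') \<in> E}"
      using measurable_space[OF \<Xi>_meas]
      by (auto simp: E_def dev_def Fe_eq Fg_eq space_pair_measure sums Z_def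
          simp del: space_PiM One_nat_def)
    have frozen: "prob {\<omega>' \<in> space M. (\<omega>, \<Xi> \<omega>') \<in> E} \<le> \<epsilon>q / \<alpha> powr (q / (q - 1))"
      if \<omega>: "\<omega> \<in> space M" for \<omega>
    proof -
      let ?n = "p (\<Delta> k \<omega>)" and ?\<delta> = "\<Delta> k \<omega>"
      let ?t = "\<alpha> * ?\<delta> powr q"
      have \<delta>: "?\<delta> > 0" using stepsize_pos[OF \<omega>] .
      have n: "?n \<ge> 1" by (rule p_ge[OF \<delta>])
      have "prob {\<omega>' \<in> space M. (\<omega>, \<Xi> \<omega>') \<in> E}
          = prob {\<omega>' \<in> space M. ?t \<le> \<bar>(\<Sum>i = 1..?n. F (X k \<omega>) (Z (Inl i) \<omega>')) / real ?n
             - (\<Sum>i = 1..?n. F (X k \<omega> + ?\<delta> *\<^sub>R G k \<omega>) (Z (Inr i) \<omega>')) / real ?n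
             - (f (X k \<omega>) - f (X k \<omega> + ?\<delta> *\<^sub>R G k \<omega>))\<bar>}"
        using measurable_space[OF \<Xi>_meas] \<omega>
        by (intro arg_cong[where f = prob])
           (auto simp: E_def dev_def space_pair_measure sums simp del: space_PiM One_nat_def)
      also have "\<dots> \<le> 2 * 2 powr r * moment_const r * max Mr 1 * real ?n powr (- (r / 2)) / ?t powr r"
      proof (rule two_sample_averages_tail[OF r indepZ[unfolded I_def] lawZ[unfolded I_def] unbiased moment(1) _ n])
        show "(\<integral>s. \<bar>F x s - f x\<bar> powr r \<partial>D) \<le> max Mr 1" for x
          using moment(2)[of x] by simp
        show "?t > 0" using \<alpha> \<delta> by simp
      qed
      also have "\<dots> \<le> \<epsilon>q * (?\<delta> powr q) powr r / ?t powr r"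
        unfolding \<epsilon>q_def
      proof (intro divide_right_mono mult_left_mono)
        have "?\<delta> powr (- b) \<le> real ?n" unfolding p_def by linarith
        then have "real ?n powr (- (r / 2)) \<le> (?\<delta> powr (- b)) powr (- (r / 2))"
          using \<delta> r by (intro powr_mono2') auto
        also have "\<dots> = (?\<delta> powr q) powr r" by (simp add: powr_powr b(3))
        finally show "real ?n powr (- (r / 2)) \<le> (?\<delta> powr q) powr r" .
      qed (use K in auto)
      also have "\<dots> = \<epsilon>q / \<alpha> powr (q / (q - 1))"
        using \<alpha> \<delta> by (simp add: powr_mult r_def)
      finally show ?thesis .
    qed
    have "AE \<omega> in M. real_cond_exp M ?H (indicator {\<omega>' \<in> space M. (\<omega>', \<Xi> \<omega>') \<in> E}) \<omega>
           = prob {\<omega>' \<in> space M. (\<omega>, \<Xi> \<omega>') \<in> E}"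
      by (rule real_cond_exp_freeze_independent[OF subalgebra_past \<Xi>_meas indep E])
    then show "AE \<omega> in M. real_cond_exp M ?H (indicator {\<omega>' \<in> space M.
             \<bar>Fe k \<omega>' - Fg k \<omega>' - (f (X k \<omega>') - f (X k \<omega>' + \<Delta> k \<omega>' *\<^sub>R G k \<omega>'))\<bar>
               \<ge> \<alpha> * \<Delta> k \<omega>' powr q}) \<omega> \<le> \<epsilon>q / \<alpha> powr (q / (q - 1))"
      unfolding event using AE_space by eventually_elim (use frozen in simp)
  qed
  then show ?thesis
    using p_ge p_bigo \<epsilon>q_pos by blast
qed

end
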